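(* Fix $L\in\mathbb{N}_+$ with $L<N$. Then $$\mathbf{b}_{n,L}=\sum_{\ell=n}^{L}(-1)^{\ell-n}\binom{L}{\ell}\binom{\ell}{n}\,\mathbf{p}_{\ell;L}\qquad\text{for each }0\le n\le L,$$ $$\mathbf{p}_{\ell;L}=\sum_{n=\ell}^{L}\frac{\binom{n}{\ell}}{\binom{L}{\ell}}\,\mathbf{b}_{n,L}\qquad\text{for each }0\le \ell\le L,$$ $$\mathbf{b}_{n,L}(\eta)\le\binom{L}{n}\,\mathbf{p}_{n;L}(\eta)\qquad\text{for each }0\le n\le L\text{ and each }\eta\in\Omega_N .$$
   Context: $N\in\mathbb{N}_+$ is fixed, $\mathbb{T}_N=\mathbb{Z}/N\mathbb{Z}$ is the one-dimensional discrete torus and $\Omega_N=\{0,1\}^{\mathbb{T}_N}$ is the set of configurations; $\eta(x)\in\{0,1\}$ is the occupation value of $\eta\in\Omega_N$ at $x\in\mathbb{T}_N$ ($1$ = particle, $0$ = vacant site). Integer intervals are written $\llbracket a,b\rrbracket=\{a,a+1,\dots,b\}$ and are viewed in $\mathbb{T}_N$. For $L\in\mathbb{N}_+$ with $L<N$ and $0\le j\le L$ put $$W_j^L=\llbracket -j,-j+L+1\rrbracket\setminus\{0,1\},$$ let $m_j^L(\eta)$ be the number of particles of $\eta$ in $W_j^L$, and let $\langle\eta\rangle_{W_j^L}=\tfrac1L m_j^L(\eta)$. For integers $0\le n\le L$ and $0\le\ell\le L$ define functions on $\Omega_N$ by $$\mathbf{b}_{n,L}=\frac{1}{L+1}\sum_{j=0}^{L}\mathbf{b}_{n,L}^j,\qquad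 \mathbf{b}_{n,L}^j(\eta)=\mathbf{1}\big\{\langle\eta\rangle_{W_j^L}=\tfrac{n}{L}\big\},$$ $$\mathbf{p}_{\ell;L}=\frac{1}{L+1}\sum_{j=0}^{L}\mathbf{p}_{\ell;L}^j,\qquad \mathbf{p}_{\ell;L}^j(\eta)=\frac{\binom{m_j^L(\eta)}{\ell}}{\binom{L}{\ell}}\,\mathbf{1}\{m_j^L(\eta)\ge\ell\}.$$ *)

theory Defs
  imports Complex_Main "HOL-Library.FuncSet"
begin

text \<open>The torus \<open>\<int>/N\<int>\<close> is represented by the residues \<open>0, \<dots>, N - 1\<close>; an integer \<open>k\<close> is viewed
  in it as \<open>k mod N\<close>.\<close>

definition torus :: "nat \<Rightarrow> int set" where
  "torus N = {0..<int N}"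

definition configs :: "nat \<Rightarrow> (int \<Rightarrow> nat) set" where
  "configs N = torus N \<rightarrow>\<^sub>E {0, 1}"

definition to_torus :: "nat \<Rightarrow> int set \<Rightarrow> int set" where
  "to_torus N A = (\<lambda>k. k mod int N) ` A"

text \<open>The set difference is taken in the torus. If \<open>L + 2 \<le> N\<close>, the integer interval embeds into
  the torus and it makes no difference whether \<open>0, 1\<close> are removed before or after projecting; the
  order matters only for \<open>L = N - 1\<close>, where the two ends of the interval are the same site.\<close>

definition window :: "nat \<Rightarrow> nat \<Rightarrow> nat \<Rightarrow> int set" where
  "window N L j = to_torus N {- int j .. - int j + int L + 1} - to_torus N {0, 1}"

definition particles :: "nat \<Rightarrow> nat \<Rightarrow> nat \<Rightarrow> (int \<Rightarrow> nat) \<Rightarrow> nat" where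
  "particles N L j \<eta> = card {x \<in> window N L j. \<eta> x = 1}"

definition window_density :: "nat \<Rightarrow> nat \<Rightarrow> nat \<Rightarrow> (int \<Rightarrow> nat) \<Rightarrow> real" where
  "window_density N L j \<eta> = 1 / real L * real (particles N L j \<eta>)"

definition b_at :: "nat \<Rightarrow> nat \<Rightarrow> nat \<Rightarrow> nat \<Rightarrow> (int \<Rightarrow> nat) \<Rightarrow> real" where
  "b_at N n L j \<eta> = of_bool (window_density N L j \<eta> = real n / real L)"

definition b_fun :: "nat \<Rightarrow> nat \<Rightarrow> nat \<Rightarrow> (int \<Rightarrow> nat) \<Rightarrow> real" where
  "b_fun N n L \<eta> = 1 / real (L + 1) * (\<Sum>j=0..L. b_at N n L j \<eta>)"

definition p_at :: "nat \<Rightarrow> nat \<Rightarrow> nat \<Rightarrow> nat \<Rightarrow> (int \<Rightarrow> nat) \<Rightarrow> real" where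
  "p_at N l L j \<eta> =
     real (particles N L j \<eta> choose l) / real (L choose l) * of_bool (particles N L j \<eta> \<ge> l)"

definition p_fun :: "nat \<Rightarrow> nat \<Rightarrow> nat \<Rightarrow> (int \<Rightarrow> nat) \<Rightarrow> real" where
  "p_fun N l L \<eta> = 1 / real (L + 1) * (\<Sum>j=0..L. p_at N l L j \<eta>)"

end

theory Submission
  imports Defs
begin

text \<open>For each window, the three relations are pointwise facts about the number \<open>m\<close> of particles in
  it: the first is binomial inversion, and the other two are immediate. The sums reach far enough because
  \<open>m \<le> L\<close>.\<close>

text \<open>Projecting before removing 0 and 1 can only lose sites, and projecting never increases
  cardinality. For \<open>j \<le> L\<close> the interval of \<open>L + 2\<close> integers contains
  both 0 and 1, so \<open>L\<close> remain. The bound is strict when \<open>L = N - 1\<close> with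
  \<open>L > 0\<close>, because the two ends of the interval project to the same site.\<close>

lemma card_window_le:
  assumes "j \<le> L"
  shows "card (window N L j) \<le> L"
proof -
  let ?I = "{- int j .. - int j + int L + 1}"
  have "window N L j \<subseteq> to_torus N (?I - {0, 1})"
    by (auto simp: window_def to_torus_def)
  then have "card (window N L j) \<le> card (to_torus N (?I - {0, 1}))"
    by (intro card_mono) (auto simp: to_torus_def)
  also have "\<dots> \<le> card (?I - {0, 1})"
    unfolding to_torus_def by (intro card_image_le) auto
  also have "\<dots> = L"
    using assms by (subst card_Diff_subset) auto
  finally show ?thesis .
qed

lemma particles_le:
  assumes "j \<le> L"
  shows "particles N L j \<eta> \<le> L"
proof -
  have "finite (window N L j)"
    by (simp add: window_def to_torus_def)
  then have "particles N L j \<eta> \<le> card (window N L j)"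
    unfolding particles_def by (intro card_mono) auto
  with card_window_le[OF assms] show ?thesis
    by (rule le_trans[rotated])
qed

lemma b_at_eq:
  assumes "0 < L"
  shows "b_at N n L j \<eta> = of_bool (particles N L j \<eta> = n)"
  using assms by (simp add: b_at_def window_density_def)

lemma p_at_eq: "p_at N l L j \<eta> = real (particles N L j \<eta> choose l) / real (L choose l)"
  by (cases "l \<le> particles N L j \<eta>") (simp_all add: p_at_def)

text \<open>Orthogonality of binomial coefficients: once \<open>m choose n\<close> is factored out,
  what remains is the expansion of (1 - 1)^(m - n).\<close>

lemma choose_inversion:
  fixes m n L :: nat
  assumes "m \<le> L"
  shows "(\<Sum>l=n..L. (-1) ^ (l - n) * real (l choose n) * real (m choose l)) = of_bool (m = n)"
proof (cases "n \<le> m")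
  case True
  \<comment> \<open>The terms with \<open>l > m\<close> vanish, since then
    \<open>m choose l = 0\<close>.\<close>
  have "(\<Sum>l=n..L. (-1) ^ (l - n) * real (l choose n) * real (m choose l)) =
      (\<Sum>l=n..m. (-1) ^ (l - n) * real (l choose n) * real (m choose l))"
    using assms by (intro sum.mono_neutral_right) auto
  also have "\<dots> = (\<Sum>l=n..m. real (m choose n) * ((-1) ^ (l - n) * real ((m - n) choose (l - n))))"
  proof (intro sum.cong refl)
    fix l assume "l \<in> {n..m}"
    then have "real (m choose l) * real (l choose n) =
        real (m choose n) * real ((m - n) choose (l - n))"
      by (simp flip: of_nat_mult add: choose_mult)
    then show "(-1) ^ (l - n) * real (l choose n) * real (m choose l) =
        real (m choose n) * ((-1) ^ (l - n) * real ((m - n) choose (l - n)))"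
      by (simp add: mult_ac)
  qed
  also have "\<dots> = real (m choose n) * (\<Sum>i\<le>m - n. (-1) ^ i * real ((m - n) choose i))"
    unfolding sum_distrib_left[symmetric]
    by (intro arg_cong[of _ _ "(*) _"] sum.reindex_bij_witness[of _ "\<lambda>i. i + n" "\<lambda>l. l - n"])
      (use True in auto)
  also have "\<dots> = of_bool (m = n)"
    using True by (cases "m = n") (simp_all add: choose_alternating_sum)
  finally show ?thesis .
next
  case False
  \<comment> \<open>Here \<open>m < n \<le> l\<close>, so every \<open>m choose l\<close> is
    0.\<close>
  then show ?thesis by (auto intro!: sum.neutral)
qed

text \<open>Since \<open>l \<le> L\<close>, the factor \<open>L choose l\<close> cancels the
  denominator of \<open>p_at\<close>; the rest is \<open>choose_inversion\<close> with the particle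
  number as \<open>m\<close>.\<close>

lemma b_at_eq_sum_p_at:
  assumes "0 < L" "j \<le> L"
  shows "b_at N n L j \<eta> =
    (\<Sum>l=n..L. (-1) ^ (l - n) * real (L choose l) * real (l choose n) * p_at N l L j \<eta>)"
proof -
  have "(\<Sum>l=n..L. (-1) ^ (l - n) * real (L choose l) * real (l choose n) * p_at N l L j \<eta>) =
      (\<Sum>l=n..L. (-1) ^ (l - n) * real (l choose n) * real (particles N L j \<eta> choose l))"
    by (intro sum.cong refl) (simp add: p_at_eq)
  also have "\<dots> = b_at N n L j \<eta>"
    using assms by (simp add: choose_inversion particles_le b_at_eq)
  finally show ?thesis by simp
qed

lemma p_at_eq_sum_b_at:
  assumes "0 < L" "j \<le> L"
  shows "p_at N l L j \<eta> = (\<Sum>n=l..L. real (n choose l) / real (L choose l) * b_at N n L j \<eta>)"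
proof -
  let ?m = "particles N L j \<eta>"
  have "(\<Sum>n=l..L. real (n choose l) / real (L choose l) * b_at N n L j \<eta>) =
      (\<Sum>n=l..L. if n = ?m then real (n choose l) / real (L choose l) else 0)"
    using assms by (intro sum.cong refl) (simp add: b_at_eq)
  also have "\<dots> = p_at N l L j \<eta>"
    \<comment> \<open>Only \<open>n = ?m\<close> contributes. As \<open>?m \<le> L\<close>, it can
      miss the range only if \<open>?m < l\<close>, and then \<open>?m choose l = 0\<close> agrees
      with the vanishing sum.\<close>
    using particles_le[OF assms(2), of N \<eta>] by (simp add: p_at_eq)
  finally show ?thesis by simp
qed

text \<open>After cancellation the right-hand side is \<open>m choose n\<close> for the particle
  number \<open>m\<close>: it equals 1 at \<open>m = n\<close> and is nonnegative elsewhere.\<close>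

lemma b_at_le_p_at:
  assumes "0 < L" "n \<le> L"
  shows "b_at N n L j \<eta> \<le> real (L choose n) * p_at N n L j \<eta>"
  using assms by (simp add: b_at_eq p_at_eq)

theorem proposition2p6:
  fixes N L :: nat
  assumes "0 < N" and "0 < L" and "L < N"
  shows "(\<forall>n\<le>L. \<forall>\<eta>\<in>configs N.
            b_fun N n L \<eta> =
              (\<Sum>l=n..L. (-1) ^ (l - n) * real (L choose l) * real (l choose n) * p_fun N l L \<eta>)) \<and>
         (\<forall>l\<le>L. \<forall>\<eta>\<in>configs N.
            p_fun N l L \<eta> = (\<Sum>n=l..L. real (n choose l) / real (L choose l) * b_fun N n L \<eta>)) \<and>
         (\<forall>n\<le>L. \<forall>\<eta>\<in>configs N. b_fun N n L \<eta> \<le> real (L choose n) * p_fun N n L \<eta>)"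
proof -
  \<comment> \<open>The coefficients \<open>c i\<close> do not depend on the window index
    \<open>j\<close>, so a linear identity valid for each window passes to the averages by
    exchanging the sums.\<close>
  have average_sum: "1 / real (L + 1) * (\<Sum>j=0..L. f j) =
      (\<Sum>i=k..L. c i * (1 / real (L + 1) * (\<Sum>j=0..L. g i j)))"
    if "\<And>j. j \<le> L \<Longrightarrow> f j = (\<Sum>i=k..L. c i * g i j)"
    for f :: "nat \<Rightarrow> real" and c :: "nat \<Rightarrow> real" and g :: "nat \<Rightarrow> nat \<Rightarrow> real" and k :: nat
  proof -
    have "(\<Sum>j=0..L. f j) = (\<Sum>i=k..L. \<Sum>j=0..L. c i * g i j)"
      using that by (subst sum.swap) simp
    then show ?thesis
      by (simp only: sum_distrib_left mult.left_commute)
  qed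
  have "b_fun N n L \<eta> =
      (\<Sum>l=n..L. (-1) ^ (l - n) * real (L choose l) * real (l choose n) * p_fun N l L \<eta>)" for n \<eta>
    unfolding b_fun_def p_fun_def by (rule average_sum) (rule b_at_eq_sum_p_at[OF assms(2)])
  moreover have "p_fun N l L \<eta> = (\<Sum>n=l..L. real (n choose l) / real (L choose l) * b_fun N n L \<eta>)"
    for l \<eta>
    unfolding b_fun_def p_fun_def by (rule average_sum) (rule p_at_eq_sum_b_at[OF assms(2)])
  moreover have "b_fun N n L \<eta> \<le> real (L choose n) * p_fun N n L \<eta>" if "n \<le> L" for n \<eta>
  proof -
    have "(\<Sum>j=0..L. b_at N n L j \<eta>) \<le> real (L choose n) * (\<Sum>j=0..L. p_at N n L j \<eta>)"
      unfolding sum_distrib_left using assms(2) that by (intro sum_mono b_at_le_p_at)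
    then show ?thesis
      by (simp add: b_fun_def p_fun_def divide_right_mono)
  qed
  ultimately show ?thesis by blast
qed

end
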